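(* Let $\mathcal X,\mathcal Y$ be complex Hilbert spaces, let $E$ and $Q$ be bounded linear operators from $\mathcal X$ to $\mathcal Y$ with $Q$ boundedly invertible and $Q^*E$ selfadjoint and nonnegative (i.e. $\langle Q^*Ex,x\rangle\ge 0$ for all $x\in\mathcal X$), let $B$ be a closed, densely defined, dissipative operator in $\mathcal Y$, and let $T>0$. For $x_0\in\mathcal X$ consider the Cauchy problem $$E\dot x(t)=BQx(t),\quad x(0)=x_0,\quad t\in[0,T].$$ Then the following statements are equivalent: (c') $\ker E\cap\ker(BQ)=\{0\}$; (e') whenever $x_1(t),x_2(t)$ are two mild solutions of this Cauchy problem with the same initial condition $x_0\in\mathcal X$, then $x_1(t)=x_2(t)$ for all $t\in[0,T]$.
   Context: Dissipative means $\operatorname{Re}\langle Bx,x\rangle\le 0$ for all $x\in\mathcal D(B)\subseteq\mathcal Y$. The operator $BQ$ has domain $\mathcal D(BQ)=\{x\in\mathcal X:Qx\in\mathcal D(B)\}$. A mild solution of $E\dot x=Ax$, $x(0)=x_0$ on $[0,T]$ (here $A=BQ$) is a continuous $\mathcal X$-valued function $x$ on $[0,T]$ with $x(0)=x_0$ such that for all $t\in[0,T]$ one has $\int_0^tx(s)\,ds\in\mathcal D(A)$ and $Ex(t)-A\int_0^tx(s)\,ds=Ex_0$. *)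

theory Defs
  imports "HOL-Analysis.Analysis"
begin

text \<open>
  Complex Hilbert spaces.  The inner product is linear in its first argument.  Real scalar
  multiplication, norm, topology and completeness are those of class \<open>banach\<close>; the axioms
  tie them to the complex structure.
\<close>

class chilbert_space = banach +
  fixes scaleC :: "complex \<Rightarrow> 'a \<Rightarrow> 'a"  (infixr \<open>*\<^sub>C\<close> 75)
    and cinner :: "'a \<Rightarrow> 'a \<Rightarrow> complex"
  assumes scaleC_add_right: "a *\<^sub>C (x + y) = a *\<^sub>C x + a *\<^sub>C y"
    and scaleC_add_left: "(a + b) *\<^sub>C x = a *\<^sub>C x + b *\<^sub>C x"
    and scaleC_scaleC: "a *\<^sub>C (b *\<^sub>C x) = (a * b) *\<^sub>C x"
    and scaleC_one: "1 *\<^sub>C x = x"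
    and scaleR_scaleC: "r *\<^sub>R x = complex_of_real r *\<^sub>C x"
    and cinner_commute: "cinner x y = cnj (cinner y x)"
    and cinner_add_left: "cinner (x + y) z = cinner x z + cinner y z"
    and cinner_scaleC_left: "cinner (a *\<^sub>C x) y = a * cinner x y"
    and cinner_self_nonneg: "cinner x x \<in> \<real>\<^sub>\<ge>\<^sub>0"
    and cinner_eq_zero_iff: "cinner x x = 0 \<longleftrightarrow> x = 0"
    and norm_eq_sqrt_cinner: "norm x = sqrt (Re (cinner x x))"

definition bounded_clinear :: "('a::chilbert_space \<Rightarrow> 'b::chilbert_space) \<Rightarrow> bool" where
  "bounded_clinear A \<longleftrightarrow> bounded_linear A \<and> (\<forall>c x. A (c *\<^sub>C x) = c *\<^sub>C A x)"

definition boundedly_invertible :: "('a::chilbert_space \<Rightarrow> 'b::chilbert_space) \<Rightarrow> bool" where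
  "boundedly_invertible A \<longleftrightarrow> (\<exists>R. bounded_clinear R \<and> R \<circ> A = id \<and> A \<circ> R = id)"

text \<open>
  The Hilbert space adjoint.  For bounded operators it exists and is unique by the Riesz
  representation theorem; the definition is only meant for such operators.
\<close>

definition cadjoint :: "('a::chilbert_space \<Rightarrow> 'b::chilbert_space) \<Rightarrow> 'b \<Rightarrow> 'a" where
  "cadjoint A = (SOME A'. \<forall>x y. cinner (A x) y = cinner x (A' y))"

definition selfadjoint :: "('a::chilbert_space \<Rightarrow> 'a) \<Rightarrow> bool" where
  "selfadjoint A \<longleftrightarrow> bounded_clinear A \<and> cadjoint A = A"

definition nonnegative :: "('a::chilbert_space \<Rightarrow> 'a) \<Rightarrow> bool" where
  "nonnegative A \<longleftrightarrow> (\<forall>x. cinner (A x) x \<in> \<real>\<^sub>\<ge>\<^sub>0)"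

text \<open>
  A possibly unbounded operator is given by its domain \<open>D\<close> together with a total function
  whose values outside \<open>D\<close> are irrelevant.
\<close>

definition clinear_operator ::
    "'a::chilbert_space set \<Rightarrow> ('a \<Rightarrow> 'b::chilbert_space) \<Rightarrow> bool" where
  "clinear_operator D A \<longleftrightarrow>
     0 \<in> D \<and>
     (\<forall>x\<in>D. \<forall>y\<in>D. x + y \<in> D \<and> A (x + y) = A x + A y) \<and>
     (\<forall>c. \<forall>x\<in>D. c *\<^sub>C x \<in> D \<and> A (c *\<^sub>C x) = c *\<^sub>C A x)"

definition closed_operator ::
    "'a::chilbert_space set \<Rightarrow> ('a \<Rightarrow> 'b::chilbert_space) \<Rightarrow> bool" where
  "closed_operator D A \<longleftrightarrow> closed ((\<lambda>x. (x, A x)) ` D)"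

definition densely_defined :: "'a::chilbert_space set \<Rightarrow> bool" where
  "densely_defined D \<longleftrightarrow> closure D = UNIV"

definition dissipative ::
    "'a::chilbert_space set \<Rightarrow> ('a \<Rightarrow> 'a) \<Rightarrow> bool" where
  "dissipative D A \<longleftrightarrow> (\<forall>x\<in>D. Re (cinner (A x) x) \<le> 0)"

definition op_kernel ::
    "'a::chilbert_space set \<Rightarrow> ('a \<Rightarrow> 'b::chilbert_space) \<Rightarrow> 'a set" where
  "op_kernel D A = {x \<in> D. A x = 0}"

definition comp_domain ::
    "'b::chilbert_space set \<Rightarrow> ('a::chilbert_space \<Rightarrow> 'b) \<Rightarrow> 'a set" where
  "comp_domain D Q = {x. Q x \<in> D}"

text \<open>
  Mild solutions of \<open>E x' = A x\<close>, \<open>x(0) = x0\<close> on \<open>[0, T]\<close>, where \<open>A\<close> has domain \<open>D\<close>.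
  Functions on \<open>[0, T]\<close> are total functions whose values outside \<open>[0, T]\<close> are irrelevant.
\<close>

definition mild_solution ::
    "('a::chilbert_space \<Rightarrow> 'b::chilbert_space) \<Rightarrow> 'a set \<Rightarrow> ('a \<Rightarrow> 'b) \<Rightarrow> real \<Rightarrow> 'a
      \<Rightarrow> (real \<Rightarrow> 'a) \<Rightarrow> bool" where
  "mild_solution E D A T x0 x \<longleftrightarrow>
     continuous_on {0..T} x \<and> x 0 = x0 \<and>
     (\<forall>t\<in>{0..T}. integral {0..t} x \<in> D \<and> E (x t) - A (integral {0..t} x) = E x0)"

end

theory Submission
  imports Defs
begin

text \<open>
  Uniqueness is an energy argument.  If two mild solutions start at the same point, let \<open>x\<close> be
  their difference and \<open>y(t)\<close> the integral of \<open>x\<close> over \<open>[0, t]\<close>, so that \<open>y\<close> is differentiable,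
  \<open>y(0) = 0\<close> and \<open>E y' = B Q y\<close>.  As \<open>S = Q\<^sup>* E\<close> is symmetric, the energy \<open>\<langle>S y, y\<rangle>\<close>
  has derivative \<open>2 Re \<langle>E y', Q y\<rangle> = 2 Re \<langle>B Q y, Q y\<rangle>\<close>, which is at most \<open>0\<close> by
  dissipativity.  The energy starts at \<open>0\<close> and is nonnegative, hence vanishes identically.  For a
  nonnegative symmetric \<open>S\<close> this forces \<open>S y = 0\<close> (\<open>nonnegative_form_zero\<close>), and since \<open>Q\<close> is
  onto, \<open>E y = 0\<close>.  Differentiating, \<open>B Q y = E y' = 0\<close>.  So \<open>y(t)\<close> lies in
  \<open>ker E \<inter> ker (B Q)\<close>, and when this intersection is trivial \<open>x = y' = 0\<close>.

  Conversely, a vector \<open>v\<close> in both kernels gives the mild solution \<open>t \<mapsto> t v\<close> with initial value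
  \<open>0\<close>, and comparing it with the zero solution gives \<open>v = 0\<close>.

  The adjoint \<open>Q\<^sup>*\<close> is a Hilbert choice, so using it requires the Riesz representation theorem.
  It is enough to represent real functionals by the real part of the inner product, which is
  a real inner product inducing the norm; the imaginary part follows by complex linearity.
\<close>

section \<open>The real part of the inner product\<close>

lemma cinner_add_right: "cinner x (y + z) = cinner x y + cinner x z"
  by (metis cinner_add_left cinner_commute complex_cnj_add)

lemma Re_cinner_commute: "Re (cinner x y) = Re (cinner y x)"
  using arg_cong[OF cinner_commute[of x y], of Re] by simp

lemma Re_cinner_scaleR_left: "Re (cinner (r *\<^sub>R x) y) = r * Re (cinner x y)"
  by (simp add: scaleR_scaleC cinner_scaleC_left)

lemma Re_cinner_scaleR_right: "Re (cinner x (r *\<^sub>R y)) = r * Re (cinner x y)"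
  by (metis Re_cinner_commute Re_cinner_scaleR_left)

lemma norm_square_cinner: "(norm x)\<^sup>2 = Re (cinner x x)"
  using cinner_self_nonneg[of x]
  by (auto simp: norm_eq_sqrt_cinner complex_nonneg_Reals_iff)

lemma norm_square_add:
  fixes x y :: "'a::chilbert_space"
  shows "(norm (x + y))\<^sup>2 = (norm x)\<^sup>2 + (norm y)\<^sup>2 + 2 * Re (cinner x y)"
  using Re_cinner_commute[of x y]
  by (simp add: norm_square_cinner cinner_add_left cinner_add_right)

text \<open>
  The norm is known to satisfy the triangle inequality, so the Cauchy--Schwarz inequality
  follows from it by expanding \<open>\<parallel>x + y\<parallel>\<^sup>2\<close>.
\<close>

lemma Re_cinner_le:
  fixes x y :: "'a::chilbert_space"
  shows "Re (cinner x y) \<le> norm x * norm y"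
proof -
  have "(norm (x + y))\<^sup>2 \<le> (norm x + norm y)\<^sup>2"
    by (simp add: norm_triangle_ineq power_mono)
  then show ?thesis
    by (simp add: norm_square_add power2_sum)
qed

lemma abs_Re_cinner_le:
  fixes x y :: "'a::chilbert_space"
  shows "\<bar>Re (cinner x y)\<bar> \<le> norm x * norm y"
  using Re_cinner_le[of x y] Re_cinner_le[of "-1 *\<^sub>R x" y] Re_cinner_scaleR_left[of "-1" x y]
  by simp

lemma bounded_bilinear_Re_cinner:
  "bounded_bilinear (\<lambda>x y :: 'a::chilbert_space. Re (cinner x y))"
proof
  show "\<exists>K. \<forall>a b :: 'a. norm (Re (cinner a b)) \<le> norm a * norm b * K"
    by (rule exI[of _ 1]) (simp add: abs_Re_cinner_le)
qed (simp_all add: cinner_add_left cinner_add_right Re_cinner_scaleR_left Re_cinner_scaleR_right)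

text \<open>
  The first-order condition at a minimum: used for the minimiser in the Riesz theorem and for
  null vectors of a nonnegative form.
\<close>

lemma linear_term_zero_if_nonneg:
  fixes a c :: real
  assumes "\<And>t. 0 \<le> 2 * t * a + t\<^sup>2 * c" and "0 \<le> c"
  shows "a = 0"
proof -
  define t where "t = - a / (c + 1)"
  have a: "a = - t * (c + 1)" using assms(2) by (simp add: t_def)
  have "0 \<le> 2 * t * a + t\<^sup>2 * c" by (rule assms)
  also have "\<dots> = - (t\<^sup>2 * (c + 2))" by (simp add: a power2_eq_square algebra_simps)
  finally have "t\<^sup>2 * (c + 2) \<le> 0" by simp
  then have "t = 0" using assms(2) by (simp add: mult_le_0_iff)
  then show ?thesis by (simp add: a)
qed

section \<open>Riesz representation and adjoints\<close>

text \<open>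
  The representing vector minimises \<open>J(x) = \<parallel>x\<parallel>\<^sup>2 / 2 - f x\<close>.  The linear part of \<open>J\<close> cancels in
  \<open>J(x) + J(y) - 2 J((x + y) / 2)\<close>, which by the parallelogram law equals \<open>\<parallel>x - y\<parallel>\<^sup>2 / 4\<close>; so
  minimising sequences are Cauchy.
\<close>

theorem riesz_representation_Re:
  fixes f :: "'a::chilbert_space \<Rightarrow> real"
  assumes f: "bounded_linear f"
  shows "\<exists>u. \<forall>v. f v = Re (cinner u v)"
proof -
  interpret f: bounded_linear f by (rule f)
  define J where "J x = (norm x)\<^sup>2 / 2 - f x" for x
  define m where "m = Inf (range J)"
  obtain K where K: "\<And>x. norm (f x) \<le> norm x * K"
    using f.bounded by blast
  have "J x \<ge> - (K\<^sup>2 / 2)" for x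
  proof -
    have "f x \<le> norm x * K" using K[of x] by simp
    moreover have "0 \<le> (norm x - K)\<^sup>2" by simp
    ultimately show ?thesis by (simp add: J_def power2_diff)
  qed
  then have bdd: "bdd_below (range J)" by (auto intro!: bdd_belowI)
  then have m_le: "m \<le> J x" for x
    unfolding m_def by (simp add: cInf_lower)
  have "\<exists>x. J x < m + inverse (real (Suc n))" for n
    using cInf_lessD[of "range J" "m + inverse (real (Suc n))"] by (auto simp: m_def)
  then obtain X where X: "\<And>n. J (X n) < m + inverse (real (Suc n))" by metis
  have par: "(norm (x - y))\<^sup>2 / 4 = J x + J y - 2 * J ((1/2) *\<^sub>R (x + y))" for x y
  proof -
    have "(norm (x - y))\<^sup>2 = (norm x)\<^sup>2 + (norm y)\<^sup>2 - 2 * Re (cinner x y)"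
      using norm_square_add[of x "-1 *\<^sub>R y"] Re_cinner_scaleR_right[of x "-1" y] by simp
    then show ?thesis
      by (simp add: J_def norm_square_add f.scaleR f.add power_mult_distrib power2_eq_square
          flip: scaleR_add_right) (simp add: norm_square_add field_simps flip: power2_eq_square)
  qed
  have "Cauchy X"
  proof (rule metric_CauchyI)
    fix e :: real assume "e > 0"
    then obtain N where N: "inverse (real (Suc N)) < e\<^sup>2 / 8"
      using reals_Archimedean[of "e\<^sup>2 / 8"] by auto
    have "dist (X i) (X j) < e" if "i \<ge> N" "j \<ge> N" for i j
    proof -
      have "J (X k) < m + e\<^sup>2 / 8" if "k \<ge> N" for k
      proof -
        have "inverse (real (Suc k)) \<le> inverse (real (Suc N))"
          using that by (simp add: field_simps)
        then show ?thesis using X[of k] N by linarith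
      qed
      from this[OF \<open>i \<ge> N\<close>] this[OF \<open>j \<ge> N\<close>] have "(norm (X i - X j))\<^sup>2 < e\<^sup>2"
        using par[of "X i" "X j"] m_le[of "(1/2) *\<^sub>R (X i + X j)"] by linarith
      then show ?thesis
        using \<open>e > 0\<close> by (simp add: dist_norm power2_less_imp_less)
    qed
    then show "\<exists>N. \<forall>i\<ge>N. \<forall>j\<ge>N. dist (X i) (X j) < e" by blast
  qed
  then obtain u where u: "X \<longlonglongrightarrow> u"
    using Cauchy_convergent convergent_def by blast
  have lim1: "(\<lambda>n. J (X n)) \<longlonglongrightarrow> J u"
    unfolding J_def by (intro tendsto_intros u f.tendsto) simp
  have lim2: "(\<lambda>n. m + inverse (real (Suc n))) \<longlonglongrightarrow> m"
    using tendsto_add[OF tendsto_const LIMSEQ_inverse_real_of_nat, of m] by simp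
  have min: "J u \<le> m"
    by (rule LIMSEQ_le[OF lim1 lim2]) (use X less_imp_le in blast)
  have "f v = Re (cinner u v)" for v
  proof -
    have "0 \<le> 2 * t * (Re (cinner u v) - f v) + t\<^sup>2 * (norm v)\<^sup>2" for t
    proof -
      have "J u \<le> J (u + t *\<^sub>R v)" using min m_le by (rule order_trans)
      then show ?thesis
        by (simp add: J_def norm_square_add Re_cinner_scaleR_right f.add f.scaleR
            power_mult_distrib field_simps)
    qed
    then have "Re (cinner u v) - f v = 0"
      by (rule linear_term_zero_if_nonneg) simp
    then show ?thesis by simp
  qed
  then show ?thesis by blast
qed

lemma cinner_cadjoint:
  fixes A :: "'a::chilbert_space \<Rightarrow> 'b::chilbert_space"
  assumes A: "bounded_clinear A"
  shows "cinner (A x) y = cinner x (cadjoint A y)"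
proof -
  have lin: "bounded_linear A" and scale: "\<And>c x. A (c *\<^sub>C x) = c *\<^sub>C A x"
    using A by (auto simp: bounded_clinear_def)
  have "\<exists>u. \<forall>x. cinner (A x) y = cinner x u" for y
  proof -
    have "bounded_linear (\<lambda>x. Re (cinner (A x) y))"
      by (rule bounded_linear_compose[OF
            bounded_bilinear.bounded_linear_left[OF bounded_bilinear_Re_cinner] lin])
    then obtain u where u: "\<And>x. Re (cinner (A x) y) = Re (cinner u x)"
      using riesz_representation_Re[of "\<lambda>x. Re (cinner (A x) y)"] by metis
    have "cinner (A x) y = cinner x u" for x
    proof (rule complex_eqI)
      show "Re (cinner (A x) y) = Re (cinner x u)"
        using u Re_cinner_commute by metis
      \<comment> \<open>Since \<open>Re (\<i> z) = - Im z\<close>, imaginary parts are real parts at \<open>\<i> x\<close>.\<close>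
      have "Re (cinner (A (\<i> *\<^sub>C x)) y) = Re (cinner (\<i> *\<^sub>C x) u)"
        using u Re_cinner_commute by metis
      then show "Im (cinner (A x) y) = Im (cinner x u)"
        by (simp add: scale cinner_scaleC_left)
    qed
    then show ?thesis by blast
  qed
  then obtain A' where "\<forall>x y. cinner (A x) y = cinner x (A' y)" by metis
  then have "\<forall>x y. cinner (A x) y = cinner x (cadjoint A y)"
    unfolding cadjoint_def by (rule someI[where P="\<lambda>A'. \<forall>x y. cinner (A x) y = cinner x (A' y)"])
  then show ?thesis by blast
qed

lemma cadjoint_eq_zeroD:
  assumes Q: "bounded_clinear Q" and "surj Q" and "cadjoint Q y = 0"
  shows "y = 0"
proof -
  obtain x where "Q x = y" using \<open>surj Q\<close> by (metis surjD)
  then have "cinner y y = cinner x 0"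
    using cinner_cadjoint[OF Q, of x y] \<open>cadjoint Q y = 0\<close> by simp
  also have "\<dots> = 0"
    using cinner_add_right[of x 0 0] by simp
  finally show ?thesis by (simp add: cinner_eq_zero_iff)
qed

text \<open>
  A null vector minimises the nonnegative form, so the form vanishes to first order there; by
  symmetry its first-order part in direction \<open>v\<close> is \<open>2 Re \<langle>S x, v\<rangle>\<close>, and \<open>v = S x\<close> is tested.
\<close>

lemma nonnegative_form_zero:
  fixes S :: "'a::chilbert_space \<Rightarrow> 'a"
  assumes lin: "bounded_linear S"
    and sym: "\<And>x y. Re (cinner (S x) y) = Re (cinner x (S y))"
    and nonneg: "\<And>x. 0 \<le> Re (cinner (S x) x)"
    and zero: "Re (cinner (S x) x) = 0"
  shows "S x = 0"
proof -
  interpret S: bounded_linear S by (rule lin)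
  have "0 \<le> 2 * t * (norm (S x))\<^sup>2 + t\<^sup>2 * Re (cinner (S (S x)) (S x))" for t
    using nonneg[of "x + t *\<^sub>R S x"] zero sym[of "S x" x]
    unfolding norm_square_cinner
    by (simp add: S.add S.scaleR cinner_add_left cinner_add_right Re_cinner_scaleR_left
        Re_cinner_scaleR_right power2_eq_square algebra_simps)
  then have "(norm (S x))\<^sup>2 = 0"
    by (rule linear_term_zero_if_nonneg) (rule nonneg)
  then show ?thesis by simp
qed

section \<open>Mild solutions\<close>

lemma clinear_operator_scaleR:
  assumes "clinear_operator D A" and "x \<in> D"
  shows "r *\<^sub>R x \<in> D" and "A (r *\<^sub>R x) = r *\<^sub>R A x"
  using assms by (auto simp: clinear_operator_def scaleR_scaleC)

lemma clinear_operator_zero: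
  assumes "clinear_operator D A"
  shows "0 \<in> D" and "A 0 = 0"
proof -
  show "0 \<in> D" using assms by (simp add: clinear_operator_def)
  then show "A 0 = 0" using clinear_operator_scaleR(2)[OF assms, of 0 0] by simp
qed

lemma clinear_operator_diff:
  assumes A: "clinear_operator D A" and x: "x \<in> D" and y: "y \<in> D"
  shows "x - y \<in> D" and "A (x - y) = A x - A y"
proof -
  note y' = clinear_operator_scaleR[OF A y, of "-1"]
  have "x + (-1) *\<^sub>R y \<in> D \<and> A (x + (-1) *\<^sub>R y) = A x + A ((-1) *\<^sub>R y)"
    using A x y'(1) unfolding clinear_operator_def by blast
  then show "x - y \<in> D" "A (x - y) = A x - A y" using y'(2) by simp_all
qed

lemma clinear_operator_comp:
  assumes "clinear_operator D B" and "bounded_clinear Q"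
  shows "clinear_operator (comp_domain D Q) (B \<circ> Q)"
proof -
  interpret Q: bounded_linear Q using assms(2) by (simp add: bounded_clinear_def)
  show ?thesis
    using assms by (simp add: clinear_operator_def comp_domain_def bounded_clinear_def Q.add Q.zero)
qed

lemma mild_solution_diff:
  assumes E: "bounded_linear E" and A: "clinear_operator D A"
    and x1: "mild_solution E D A T a x1" and x2: "mild_solution E D A T b x2"
  shows "mild_solution E D A T (a - b) (\<lambda>t. x1 t - x2 t)"
proof -
  interpret E: bounded_linear E by (rule E)
  have cont: "continuous_on {0..T} x1" "continuous_on {0..T} x2"
    using x1 x2 by (auto simp: mild_solution_def)
  have "integral {0..t} (\<lambda>s. x1 s - x2 s) \<in> D \<and>
      E (x1 t - x2 t) - A (integral {0..t} (\<lambda>s. x1 s - x2 s)) = E (a - b)" if t: "t \<in> {0..T}" for t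
  proof -
    have "continuous_on {0..t} x1" "continuous_on {0..t} x2"
      using cont t by (auto elim: continuous_on_subset)
    then have int: "integral {0..t} (\<lambda>s. x1 s - x2 s) = integral {0..t} x1 - integral {0..t} x2"
      by (simp add: integral_diff integrable_continuous_real)
    have s1: "integral {0..t} x1 \<in> D" "E (x1 t) - A (integral {0..t} x1) = E a"
      using x1 t by (auto simp: mild_solution_def)
    have s2: "integral {0..t} x2 \<in> D" "E (x2 t) - A (integral {0..t} x2) = E b"
      using x2 t by (auto simp: mild_solution_def)
    show ?thesis
      using clinear_operator_diff[OF A s1(1) s2(1)] s1(2) s2(2)
      by (simp add: int E.diff algebra_simps)
  qed
  then show ?thesis
    using x1 x2 cont by (auto simp: mild_solution_def intro: continuous_on_diff)
qed

lemma mild_solution_zero: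
  assumes "bounded_linear E" and A: "clinear_operator D A"
  shows "mild_solution E D A T 0 (\<lambda>t. 0)"
proof -
  interpret E: bounded_linear E by fact
  show ?thesis using clinear_operator_zero[OF A] by (simp add: mild_solution_def E.zero)
qed

text \<open>
  Along a common null vector of \<open>E\<close> and \<open>A\<close> the equation is void, so any continuous scalar
  function times \<open>v\<close> solves it; \<open>t v\<close> also starts at \<open>0\<close>.
\<close>

lemma mild_solution_ramp:
  assumes E: "bounded_linear E" and A: "clinear_operator D A"
    and v: "v \<in> op_kernel UNIV E \<inter> op_kernel D A"
  shows "mild_solution E D A T 0 (\<lambda>t. t *\<^sub>R v)"
proof -
  interpret E: bounded_linear E by (rule E)
  have v': "E v = 0" "v \<in> D" "A v = 0" using v by (auto simp: op_kernel_def)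
  have "integral {0..t} (\<lambda>s. s *\<^sub>R v) = integral {0..t} (\<lambda>s. s) *\<^sub>R v" for t :: real
    by (intro integral_unique has_integral_scaleR_left integrable_integral
        integrable_continuous_real continuous_intros)
  then show ?thesis
    using clinear_operator_scaleR[OF A v'(2)] v'
    by (auto simp: mild_solution_def E.scaleR E.zero intro!: continuous_intros)
qed

lemma zero_if_integrals_zero:
  fixes f :: "real \<Rightarrow> 'a::banach"
  assumes "0 < T" and cont: "continuous_on {0..T} f"
    and zero: "\<And>s. s \<in> {0..T} \<Longrightarrow> integral {0..s} f = 0" and t: "t \<in> {0..T}"
  shows "f t = 0"
proof -
  have "((\<lambda>s. integral {0..s} f) has_vector_derivative f t) (at t within {0..T})"
    using cont t by (rule integral_has_vector_derivative)
  moreover have "((\<lambda>s. integral {0..s} f) has_vector_derivative 0) (at t within {0..T})"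
    using zero t by (rule_tac has_vector_derivative_transform[OF _ _ has_vector_derivative_const]) auto
  ultimately show ?thesis
    using vector_derivative_unique_within_closed_interval[of 0 T t] \<open>0 < T\<close> t by auto
qed

text \<open>
  The energy estimate: dissipativity makes the nonnegative energy \<open>\<langle>Q\<^sup>* E y, y\<rangle>\<close> of the
  integrated solution \<open>y\<close> nonincreasing, and it starts at \<open>0\<close>.
\<close>

lemma mild_solution_integral_in_kernels:
  fixes E Q :: "'x::chilbert_space \<Rightarrow> 'y::chilbert_space"
  assumes E: "bounded_clinear E" and Q: "bounded_clinear Q" and surj: "surj Q"
    and sa: "selfadjoint (cadjoint Q \<circ> E)" and nn: "nonnegative (cadjoint Q \<circ> E)"
    and diss: "dissipative D B"
    and sol: "mild_solution E (comp_domain D Q) (B \<circ> Q) T 0 x"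
    and "T > 0" and t: "t \<in> {0..T}"
  shows "integral {0..t} x \<in> op_kernel UNIV E \<inter> op_kernel (comp_domain D Q) (B \<circ> Q)"
proof -
  define S where "S = cadjoint Q \<circ> E"
  define y where "y t = integral {0..t} x" for t
  have linS: "bounded_linear S" and linE: "bounded_linear E"
    using sa E by (auto simp: S_def selfadjoint_def bounded_clinear_def)
  interpret S: bounded_linear S by (rule linS)
  interpret E: bounded_linear E by (rule linE)
  interpret ip: bounded_bilinear "\<lambda>x y :: 'x. Re (cinner x y)"
    by (rule bounded_bilinear_Re_cinner)
  have sym: "Re (cinner (S x) y) = Re (cinner x (S y))" for x y
    using sa cinner_cadjoint[of S x y] by (simp add: S_def selfadjoint_def)
  have nonneg: "0 \<le> Re (cinner (S x) x)" for x
    using nn by (simp add: S_def nonnegative_def complex_nonneg_Reals_iff)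
  have form: "Re (cinner (S x) z) = Re (cinner (E x) (Q z))" for x z
    using cinner_cadjoint[OF Q, of z "E x"] Re_cinner_commute by (metis S_def comp_apply)
  have cont: "continuous_on {0..T} x" using sol by (simp add: mild_solution_def)
  have y_dom: "Q (y s) \<in> D" and Ex: "E (x s) = B (Q (y s))" if "s \<in> {0..T}" for s
    using sol that by (auto simp: mild_solution_def y_def comp_domain_def E.zero)
  have y': "(y has_vector_derivative x s) (at s within {0..T})" if "s \<in> {0..T}" for s
    unfolding y_def using cont that by (rule integral_has_vector_derivative)
  have y0: "y 0 = 0" by (simp add: y_def)

  have energy': "((\<lambda>s. Re (cinner (S (y s)) (y s))) has_real_derivative
      2 * Re (cinner (B (Q (y s))) (Q (y s)))) (at s within {0..T})" if s: "s \<in> {0..T}" for s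
  proof -
    have "((\<lambda>s. Re (cinner (S (y s)) (y s))) has_vector_derivative
        Re (cinner (S (y s)) (x s)) + Re (cinner (S (x s)) (y s))) (at s within {0..T})"
      using ip.has_vector_derivative[OF S.has_vector_derivative[OF y'[OF s]] y'[OF s]] .
    moreover have "Re (cinner (S (y s)) (x s)) = Re (cinner (S (x s)) (y s))"
      using sym[of "y s" "x s"] Re_cinner_commute by metis
    ultimately show ?thesis
      using form[of "x s" "y s"] Ex[OF s]
      by (simp add: has_real_derivative_iff_has_vector_derivative)
  qed
  have y_null: "E (y s) = 0" if s: "s \<in> {0..T}" for s
  proof -
    have "Re (cinner (S (y s)) (y s)) \<le> Re (cinner (S (y 0)) (y 0))"
    proof (cases "s = 0")
      case False
      then have "0 < s" using s by simp
      have deriv: "\<And>r. 0 \<le> r \<Longrightarrow> r \<le> s \<Longrightarrow>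
          ((\<lambda>s. Re (cinner (S (y s)) (y s))) has_derivative
            (*) (2 * Re (cinner (B (Q (y r))) (Q (y r))))) (at r within {0..s})"
        using DERIV_subset[OF energy', of _ "{0..s}"] s
        by (simp add: has_field_derivative_def)
      obtain r where r: "r \<in> {0<..<s}" and
        "Re (cinner (S (y s)) (y s)) - Re (cinner (S (y 0)) (y 0))
          = 2 * Re (cinner (B (Q (y r))) (Q (y r))) * (s - 0)"
        using mvt_simple[OF \<open>0 < s\<close> deriv] by blast
      moreover have "Re (cinner (B (Q (y r))) (Q (y r))) \<le> 0"
        using diss y_dom[of r] r s by (simp add: dissipative_def)
      ultimately show ?thesis
        using \<open>0 < s\<close> mult_nonpos_nonneg[of "2 * Re (cinner (B (Q (y r))) (Q (y r)))" "s - 0"]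
        by linarith
    qed simp
    then have "Re (cinner (S (y s)) (y s)) = 0"
      using nonneg[of "y s"] by (simp add: y0 S.zero ip.zero_right)
    then have "S (y s) = 0"
      using nonnegative_form_zero[OF linS sym nonneg] by blast
    then show ?thesis
      using cadjoint_eq_zeroD[OF Q surj] by (simp add: S_def)
  qed
  \<comment> \<open>\<open>E y\<close> is the integral of \<open>E x\<close>, and it vanishes on the whole interval.\<close>
  have "E (x t) = 0"
  proof (rule zero_if_integrals_zero[OF \<open>T > 0\<close> _ _ t])
    show "continuous_on {0..T} (\<lambda>s. E (x s))"
      using E.continuous_on[OF cont] .
    show "integral {0..s} (\<lambda>r. E (x r)) = 0" if s: "s \<in> {0..T}" for s
    proof -
      have "continuous_on {0..s} x" using cont by (rule continuous_on_subset) (use s in auto)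
      then have "integral {0..s} (E \<circ> x) = E (y s)"
        unfolding y_def by (intro integral_linear integrable_continuous_real linE)
      then show ?thesis using y_null[OF s] by (simp add: o_def)
    qed
  qed
  then have "B (Q (y t)) = 0" using Ex[OF t] by simp
  then show ?thesis
    using y_null[OF t] y_dom[OF t] by (simp add: y_def op_kernel_def comp_domain_def)
qed

theorem theorem48:
  fixes E Q :: "'x::chilbert_space \<Rightarrow> 'y::chilbert_space"
    and D :: "'y set" and B :: "'y \<Rightarrow> 'y" and T :: real
  assumes "bounded_clinear E"
    and "bounded_clinear Q"
    and "boundedly_invertible Q"
    and "selfadjoint (cadjoint Q \<circ> E)"
    and "nonnegative (cadjoint Q \<circ> E)"
    and "clinear_operator D B"
    and "closed_operator D B"
    and "densely_defined D"
    and "dissipative D B"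
    and "T > 0"
  shows "op_kernel UNIV E \<inter> op_kernel (comp_domain D Q) (B \<circ> Q) = {0} \<longleftrightarrow>
    (\<forall>x0 x1 x2. mild_solution E (comp_domain D Q) (B \<circ> Q) T x0 x1 \<longrightarrow>
       mild_solution E (comp_domain D Q) (B \<circ> Q) T x0 x2 \<longrightarrow>
       (\<forall>t\<in>{0..T}. x1 t = x2 t))"
  (is "?K = {0} \<longleftrightarrow> ?unique")
proof
  let ?D = "comp_domain D Q" and ?A = "B \<circ> Q"
  have linE: "bounded_linear E" using assms(1) by (simp add: bounded_clinear_def)
  have A: "clinear_operator ?D ?A" using assms(6,2) by (rule clinear_operator_comp)
  have surj: "surj Q"
    using assms(3) unfolding boundedly_invertible_def by (metis comp_apply id_apply surjI)
  {
    assume K: "?K = {0}"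
    have "x1 t = x2 t"
      if sol: "mild_solution E ?D ?A T x0 x1" "mild_solution E ?D ?A T x0 x2" and t: "t \<in> {0..T}"
      for x0 x1 x2 t
    proof -
      have diff: "mild_solution E ?D ?A T 0 (\<lambda>t. x1 t - x2 t)"
        using mild_solution_diff[OF linE A sol] by simp
      then have "integral {0..s} (\<lambda>t. x1 t - x2 t) \<in> ?K" if "s \<in> {0..T}" for s
        using mild_solution_integral_in_kernels[OF assms(1,2) surj assms(4,5,9)] assms(10) that
        by blast
      then have "integral {0..s} (\<lambda>t. x1 t - x2 t) = 0" if "s \<in> {0..T}" for s
        using K that by blast
      moreover have "continuous_on {0..T} (\<lambda>t. x1 t - x2 t)"
        using diff by (simp add: mild_solution_def)
      ultimately have "x1 t - x2 t = 0"
        using zero_if_integrals_zero[OF assms(10) _ _ t] by blast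
      then show ?thesis by simp
    qed
    then show ?unique by blast
  next
    assume unique: ?unique
    have "v = 0" if v: "v \<in> ?K" for v
    proof -
      have "T *\<^sub>R v = 0"
        using unique mild_solution_ramp[OF linE A v] mild_solution_zero[OF linE A] assms(10)
        by (metis atLeastAtMost_iff less_imp_le order_refl)
      then show ?thesis using assms(10) by simp
    qed
    moreover have "0 \<in> ?K"
      using clinear_operator_zero[OF A] linear_0[OF bounded_linear.linear[OF linE]] by (simp add: op_kernel_def)
    ultimately show "?K = {0}" by blast
  }
qed

end
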